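(* Let $p$ be an odd prime such that $(p,p)$ is hyperbolic, i.e. $1/p+1/p<1/2$. Then the regular map of type $(p,p)$ given by the generating triple $(X,Y,Z)$ of matrices described in the context is not self-Petrie-dual.
   Context: A regular map of type $(k,l)$ (vertex degree $k$, face length $l$) is identified with a group $G$ generated by three involutions $X,Y,Z$ such that $XY$, $YZ$, $ZX$ have orders exactly $2,k,l$ respectively. The map is self-Petrie-dual if $G$ has an (involutory) automorphism fixing $Y$ and $Z$ and interchanging $X$ and $XY$. The maps considered have $G$ isomorphic to $PSL(2,q)$ or $PGL(2,q)$ with $q$ a power of the odd prime $p$. Matrices are regarded up to nonzero scalar multiples, i.e. as elements of $PGL(2,K)$ with $K$ an algebraic closure of $GF(p)$. For type $(p,p)$ the generating triple is, with $\alpha^2=-1$, $$X=-\alpha\begin{pmatrix}1&0\\2&-1\end{pmatrix},\quad Y=-\alpha\begin{pmatrix}1&-1\\0&-1\end{pmatrix},\quad Z=\alpha\begin{pmatrix}1&0\\0&-1\end{pmatrix}.$$ *)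

theory Defs
  imports
    "HOL-Algebra.Algebraic_Closure_Type"
    "HOL-Algebra.Multiplicative_Group"
    "HOL-Algebra.Generated_Groups"
    "HOL-Analysis.Determinants"
    "HOL-Computational_Algebra.Primes"
begin

section \<open>Regular maps as groups with generating triples\<close>

text \<open>
  A regular map of vertex degree \<open>k\<close> and face length \<open>l\<close> is identified with its group \<open>G\<close>
  together with the generating triple \<open>(x, y, z)\<close> of involutions.
\<close>
definition regular_map ::
  "nat \<Rightarrow> nat \<Rightarrow> ('a, 'b) monoid_scheme \<Rightarrow> 'a \<Rightarrow> 'a \<Rightarrow> 'a \<Rightarrow> bool"
  where "regular_map k l G x y z \<longleftrightarrow>
    group G \<and> {x, y, z} \<subseteq> carrier G \<and> generate G {x, y, z} = carrier G \<and>
    group.ord G x = 2 \<and> group.ord G y = 2 \<and> group.ord G z = 2 \<and>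
    group.ord G (x \<otimes>\<^bsub>G\<^esub> y) = 2 \<and>
    group.ord G (y \<otimes>\<^bsub>G\<^esub> z) = k \<and>
    group.ord G (z \<otimes>\<^bsub>G\<^esub> x) = l"

text \<open>
  If \<open>x, y, z\<close> generate \<open>G\<close>, an automorphism as below is involutory, because its square
  fixes the generators; this is therefore not demanded separately.
\<close>
definition self_Petrie_dual :: "('a, 'b) monoid_scheme \<Rightarrow> 'a \<Rightarrow> 'a \<Rightarrow> 'a \<Rightarrow> bool"
  where "self_Petrie_dual G x y z \<longleftrightarrow>
    (\<exists>\<phi> \<in> iso G G. \<phi> y = y \<and> \<phi> z = z \<and>
      \<phi> x = x \<otimes>\<^bsub>G\<^esub> y \<and> \<phi> (x \<otimes>\<^bsub>G\<^esub> y) = x)"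


section \<open>The algebraic closure of the prime field\<close>

text \<open>
  In characteristic \<open>p\<close> the range of \<^term>\<open>of_nat\<close> is the prime subfield \<open>GF(p)\<close>.
\<close>
definition alg_closure_of_GF :: "'k::field itself \<Rightarrow> nat \<Rightarrow> bool"
  where "alg_closure_of_GF _ p \<longleftrightarrow>
    CHAR('k) = p \<and> algebraic_closure (ring_of_type_algebra :: 'k ring) (range of_nat)"


section \<open>The projective general linear group\<close>

definition GL2 :: "('k::field ^ 2 ^ 2) monoid"
  where "GL2 = \<lparr>carrier = {A. invertible A}, monoid.mult = (**), one = mat 1\<rparr>"

definition scalars2 :: "('k::field ^ 2 ^ 2) set"
  where "scalars2 = {mat c | c. c \<noteq> 0}"

definition PGL2 :: "('k::field ^ 2 ^ 2) set monoid"
  where "PGL2 = GL2 Mod scalars2"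

text \<open>The class of an invertible matrix up to nonzero scalar multiples.\<close>
definition pgl_class :: "'k::field ^ 2 ^ 2 \<Rightarrow> ('k ^ 2 ^ 2) set"
  where "pgl_class A = scalars2 #>\<^bsub>GL2\<^esub> A"


section \<open>The generating triple of type \<open>(p, p)\<close>\<close>

definition Xpp :: "'k::field \<Rightarrow> ('k ^ 2 ^ 2) set"
  where "Xpp \<alpha> = pgl_class (map_matrix ((*) (-\<alpha>)) (vector [vector [1, 0], vector [2, -1]]))"

definition Ypp :: "'k::field \<Rightarrow> ('k ^ 2 ^ 2) set"
  where "Ypp \<alpha> = pgl_class (map_matrix ((*) (-\<alpha>)) (vector [vector [1, -1], vector [0, -1]]))"

definition Zpp :: "'k::field \<Rightarrow> ('k ^ 2 ^ 2) set"
  where "Zpp \<alpha> = pgl_class (map_matrix ((*) \<alpha>) (vector [vector [1, 0], vector [0, -1]]))"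

definition Gpp :: "'k::field \<Rightarrow> ('k ^ 2 ^ 2) set monoid"
  where "Gpp \<alpha> = PGL2\<lparr>carrier := generate PGL2 {Xpp \<alpha>, Ypp \<alpha>, Zpp \<alpha>}\<rparr>"

end

theory Submission
  imports Defs
begin

text \<open>
  An automorphism witnessing self-Petrie-duality maps \<open>ZX\<close> to \<open>ZXY\<close>. The former is the class of
  a nontrivial unipotent matrix, so its \<open>p\<close>-th power is trivial. The latter is the class of a matrix
  \<open>A\<close> with \<open>(A - 1)\<^sup>2 = 2\<close>, so in characteristic \<open>p\<close> we get
  \<open>A\<^sup>p = 1 + (A - 1)\<^sup>p = 1 + 2 ^ ((p - 1) / 2) \<cdot> (A - 1)\<close>, which is not scalar as \<open>p\<close> is odd.
\<close>

section \<open>Entrywise computation with 2 by 2 matrices\<close>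

definition mat22 :: "'a \<Rightarrow> 'a \<Rightarrow> 'a \<Rightarrow> 'a \<Rightarrow> 'a::zero ^ 2 ^ 2"
  where "mat22 a b c d = vector [vector [a, b], vector [c, d]]"

lemma mat22_nth [simp]:
  "mat22 a b c d $ 1 $ 1 = a" "mat22 a b c d $ 1 $ 2 = b"
  "mat22 a b c d $ 2 $ 1 = c" "mat22 a b c d $ 2 $ 2 = d"
  by (simp_all add: mat22_def)

lemma mat22_eq_iff [simp]:
  "mat22 a b c d = mat22 a' b' c' d' \<longleftrightarrow> a = a' \<and> b = b' \<and> c = c' \<and> d = d'"
  by (auto simp: vec_eq_iff forall_2)

lemma mat22_mult [simp]:
  "mat22 a b c d ** mat22 a' b' c' d' =
    mat22 (a * a' + b * c') (a * b' + b * d') (c * a' + d * c') (c * b' + d * d')"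
  by (simp add: vec_eq_iff forall_2 matrix_matrix_mult_def sum_2)

lemma mat_eq_mat22: "mat a = mat22 a 0 0 a"
  by (simp add: vec_eq_iff forall_2 mat_def)

lemma map_matrix_mat22: "map_matrix f (mat22 a b c d) = mat22 (f a) (f b) (f c) (f d)"
  by (simp add: vec_eq_iff forall_2 map_matrix_def)

lemma invertible_mat22_iff [simp]:
  "invertible (mat22 a b c (d::'a::field)) \<longleftrightarrow> a * d - b * c \<noteq> 0"
  by (simp add: invertible_det_nz det_2)

text \<open>Centrality of the scalar matrices is what makes \<open>scalars2\<close> normal in
  \<open>GL2\<close>.\<close>

lemma mat_mult_commute: "mat c ** A = A ** (mat c :: 'a::comm_semiring_1 ^ 'n ^ 'n)"
  by (simp add: vec_eq_iff matrix_matrix_mult_def mat_def if_distrib if_distribR mult.commute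
      cong: if_cong)

section \<open>The general linear group and its quotient by the scalars\<close>

lemma GL2_simps [simp]:
  "A \<in> carrier GL2 \<longleftrightarrow> invertible A" "A \<otimes>\<^bsub>GL2\<^esub> B = A ** B" "\<one>\<^bsub>GL2\<^esub> = mat 1"
  by (simp_all add: GL2_def)

lemma group_GL2: "group (GL2 :: ('k::field ^ 2 ^ 2) monoid)"
proof (rule groupI)
  show "\<one>\<^bsub>GL2\<^esub> \<in> carrier (GL2 :: ('k ^ 2 ^ 2) monoid)"
    by (simp add: mat_eq_mat22)
  fix A :: "'k ^ 2 ^ 2"
  assume "A \<in> carrier GL2"
  then obtain B where "A ** B = mat 1" "B ** A = mat 1"
    by (auto simp: invertible_def)
  then show "\<exists>B\<in>carrier GL2. B \<otimes>\<^bsub>GL2\<^esub> A = \<one>\<^bsub>GL2\<^esub>"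
    by (intro bexI [of _ B]) (auto simp: invertible_def)
qed (simp_all add: invertible_mult matrix_mul_assoc)

lemma mat22_in_scalars2_iff [simp]:
  "mat22 a b c d \<in> scalars2 \<longleftrightarrow> a \<noteq> 0 \<and> b = 0 \<and> c = 0 \<and> d = a"
  by (auto simp: scalars2_def mat_eq_mat22)

lemma subgroup_scalars2: "subgroup (scalars2 :: ('k::field ^ 2 ^ 2) set) GL2"
proof (rule group.subgroupI [OF group_GL2])
  fix A :: "'k ^ 2 ^ 2"
  assume "A \<in> scalars2"
  then obtain c where c: "A = mat c" "c \<noteq> 0"
    by (auto simp: scalars2_def)
  have "inv\<^bsub>GL2\<^esub> A = mat (inverse c)"
    using c by (intro group.inv_equality [OF group_GL2]) (simp_all add: mat_eq_mat22)
  with c show "inv\<^bsub>GL2\<^esub> A \<in> scalars2"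
    by (auto simp: mat_eq_mat22)
next
  show "(scalars2 :: ('k ^ 2 ^ 2) set) \<noteq> {}"
    by (auto simp: scalars2_def intro: exI [of _ 1])
qed (auto simp: scalars2_def mat_eq_mat22)

lemma normal_scalars2: "scalars2 \<lhd> (GL2 :: ('k::field ^ 2 ^ 2) monoid)"
  by (rule group.normalI [OF group_GL2 subgroup_scalars2])
    (auto simp: r_coset_def l_coset_def scalars2_def mat_mult_commute)

lemma group_PGL2: "group (PGL2 :: ('k::field ^ 2 ^ 2) set monoid)"
  unfolding PGL2_def by (rule normal.factorgroup_is_group [OF normal_scalars2])

lemma group_hom_pgl_class: "group_hom GL2 PGL2 (pgl_class :: 'k::field ^ 2 ^ 2 \<Rightarrow> _)"
proof -
  have "pgl_class \<in> hom (GL2 :: ('k ^ 2 ^ 2) monoid) PGL2"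
    using normal.r_coset_hom_Mod [OF normal_scalars2]
    by (simp add: PGL2_def pgl_class_def [abs_def])
  then show ?thesis
    by (simp add: group_hom_def group_hom_axioms_def group_GL2 group_PGL2)
qed

lemma pgl_class_closed: "invertible A \<Longrightarrow> pgl_class A \<in> carrier PGL2"
  using group_hom.hom_closed [OF group_hom_pgl_class] by simp

lemma pgl_class_mult:
  "invertible A \<Longrightarrow> invertible B \<Longrightarrow> pgl_class A \<otimes>\<^bsub>PGL2\<^esub> pgl_class B = pgl_class (A ** B)"
  using group_hom.hom_mult [OF group_hom_pgl_class, of A B] by simp

lemma pgl_class_eq_one_iff:
  assumes "invertible A"
  shows "pgl_class A = \<one>\<^bsub>PGL2\<^esub> \<longleftrightarrow> A \<in> scalars2"
  using assms group.coset_join1 [OF group_GL2 _ _ subgroup_scalars2, of A]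
    group.coset_join2 [OF group_GL2 _ subgroup_scalars2, of A]
  by (auto simp: pgl_class_def PGL2_def FactGroup_def)

lemma pgl_class_pow:
  assumes "invertible A"
  shows "pgl_class A [^]\<^bsub>PGL2\<^esub> (n::nat) = pgl_class (A [^]\<^bsub>GL2\<^esub> n)"
  using group_hom.hom_nat_pow [OF group_hom_pgl_class, of A n] assms by simp

lemma invertible_GL2_pow:
  assumes "invertible A"
  shows "invertible (A [^]\<^bsub>GL2\<^esub> (n::nat))"
  using monoid.nat_pow_closed [OF group.is_monoid [OF group_GL2]] assms by simp

text \<open>Turns every question about orders in \<open>PGL2\<close> into a matrix
  computation.\<close>

lemma pgl_class_pow_eq_one_iff:
  "invertible A \<Longrightarrow> pgl_class A [^]\<^bsub>PGL2\<^esub> (n::nat) = \<one>\<^bsub>PGL2\<^esub> \<longleftrightarrow> A [^]\<^bsub>GL2\<^esub> n \<in> scalars2"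
  by (simp add: pgl_class_pow pgl_class_eq_one_iff invertible_GL2_pow)

text \<open>Scaling by \<open>k\<close> is multiplication by \<open>mat k\<close>, whose class is
  trivial. This strips the factors \<alpha> and -\<alpha> from the generators.\<close>

lemma pgl_class_scale:
  assumes "k \<noteq> 0" "a * d - b * c \<noteq> 0"
  shows "pgl_class (map_matrix ((*) k) (mat22 a b c d)) = pgl_class (mat22 a b c d)"
proof -
  have "map_matrix ((*) k) (mat22 a b c d) = mat k ** mat22 a b c d"
    by (simp add: map_matrix_mat22 mat_eq_mat22)
  moreover have "pgl_class (mat k) = \<one>\<^bsub>PGL2\<^esub>"
    using assms by (simp add: mat_eq_mat22 pgl_class_eq_one_iff)
  ultimately show ?thesis
    using assms pgl_class_mult [of "mat k" "mat22 a b c d"]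
      monoid.l_one [OF group.is_monoid [OF group_PGL2] pgl_class_closed, of "mat22 a b c d"]
    by (simp add: mat_eq_mat22)
qed

text \<open>The order divides the prime \<open>q\<close>, and order 1 is excluded by nontriviality.
  All orders required for type \<open>(p, p)\<close> are 2 or \<open>p\<close>, hence prime.\<close>

lemma (in group) ord_eq_prime:
  assumes "x \<in> carrier G" "Factorial_Ring.prime q" "x [^] q = \<one>" "x \<noteq> \<one>"
  shows "ord x = q"
  using assms pow_eq_id [of x q] ord_eq_1 [of x] by (auto simp: prime_nat_iff)

section \<open>Powers of the matrices of YZ, ZX and ZXY\<close>

lemma GL2_pow_two: "A [^]\<^bsub>GL2\<^esub> (2::nat) = A ** A"
  by (simp add: numeral_2_eq_2)

lemma GL2_pow_unipotent:
  "mat22 1 b 0 1 [^]\<^bsub>GL2\<^esub> (n::nat) = mat22 1 (of_nat n * b) 0 (1::'k::field)"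
  "mat22 1 0 c 1 [^]\<^bsub>GL2\<^esub> n = mat22 1 0 (of_nat n * c) (1::'k::field)"
  by (induction n) (simp_all add: mat_eq_mat22 algebra_simps)

text \<open>
  The powers of the matrix \<open>A\<close> of \<open>ZXY\<close> are computed in
  \<open>K[A] \<cong> K[t] / (t\<^sup>2 - 2)\<close>, where \<open>t\<close> stands for \<open>A - 1\<close>.
\<close>
lemma GL2_pow_ZXY:
  "\<exists>u v. mat22 1 (-1) (-2) 1 [^]\<^bsub>GL2\<^esub> (n::nat) = mat22 u (-v) (-2 * v) (u::'k::field) \<and>
    [:-2, 0, 1:] dvd [:1, 1:] ^ n - [:u, v:]"
proof (induction n)
  case 0
  show ?case
    by (rule exI [of _ 1], rule exI [of _ 0]) (simp add: mat_eq_mat22 flip: one_pCons)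
next
  case (Suc n)
  then obtain u v :: 'k and q where
    pow: "mat22 1 (-1) (-2) 1 [^]\<^bsub>GL2\<^esub> n = mat22 u (-v) (-2 * v) u" and
    q: "[:1, 1:] ^ n - [:u, v:] = [:-2, 0, 1:] * q"
    by (auto elim!: dvdE)
  \<comment> \<open>Expanding, (u + v t)(1 + t) = (u + 2 v) + (u + v) t + v (t^2 - 2), which yields
    both the new coefficients and the last summand.\<close>
  have "[:1, 1:] ^ Suc n - [:u + 2 * v, u + v:] =
      [:1, 1:] * ([:1, 1:] ^ n - [:u, v:]) + [:-2, 0, 1:] * [:v:]"
    by (simp add: algebra_simps)
  also have "[:-2, 0, 1:] dvd \<dots>"
    unfolding q by (intro dvd_add dvd_mult dvd_triv_left)
  finally show ?case
    using pow by (intro exI [of _ "u + 2 * v"] exI [of _ "u + v"]) (simp add: algebra_simps)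
qed

lemma dvd_power_diff: "(x - y) dvd (x ^ n - y ^ n :: 'a::comm_ring_1)"
  by (simp add: power_diff_sumr2)

lemma two_nonzero:
  assumes "Factorial_Ring.prime CHAR('a)" "odd CHAR('a)"
  shows "(2::'a::semiring_1) \<noteq> 0"
  using assms of_nat_eq_0_iff_char_dvd [of 2, where ?'a = 'a]
    primes_dvd_imp_eq [OF assms(1) two_is_prime_nat] by auto

text \<open>The remainder of (1 + t)^p modulo t^2 - 2 is unique, so the entries of the matrix power
  can be read off a second computation of this remainder.\<close>

lemma GL2_pow_ZXY_not_scalar:
  assumes "Factorial_Ring.prime p" "odd p" "CHAR('k::field) = p"
  shows "mat22 1 (-1) (-2) (1::'k) [^]\<^bsub>GL2\<^esub> p \<notin> scalars2"
proof
  assume scalar: "mat22 1 (-1) (-2) (1::'k) [^]\<^bsub>GL2\<^esub> p \<in> scalars2"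
  obtain u v :: 'k where
    pow: "mat22 1 (-1) (-2) 1 [^]\<^bsub>GL2\<^esub> p = mat22 u (-v) (-2 * v) u" and
    uv: "[:-2, 0, 1:] dvd [:1, 1:] ^ p - [:u, v:]"
    using GL2_pow_ZXY by blast
  obtain m where m: "p = Suc (2 * m)"
    using assms(2) by (auto elim: oddE)
  \<comment> \<open>Polynomials over \<open>'k\<close> form a commutative ring of characteristic
    \<open>p\<close>, so p-th powers are additive there.\<close>
  have "[:1, 1:] ^ p = (1 + [:0, 1::'k:]) ^ p"
    by (simp add: one_pCons)
  also have "\<dots> = 1 + [:0, 1:] ^ p"
    using assms by (subst freshmans_dream) simp_all
  also have "[:0, 1:] ^ p = [:0, 1:] * [:0, 0, 1::'k:] ^ m"
    by (simp add: m power_mult power2_eq_square)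
  finally have "[:1, 1:] ^ p - [:1, 2 ^ m:] = [:0, 1:] * ([:0, 0, 1::'k:] ^ m - [:2:] ^ m)"
    by (simp add: algebra_simps one_pCons poly_const_pow)
  \<comment> \<open>Modulo t^2 - 2, the factor (t^2)^m may be replaced by 2^m.\<close>
  moreover have "[:-2, 0, 1:] dvd [:0, 0, 1::'k:] ^ m - [:2:] ^ m"
    using dvd_power_diff [of "[:0, 0, 1::'k:]" "[:2:]" m] by simp
  ultimately have "[:-2, 0, 1:] dvd [:1, 1:] ^ p - [:1, 2 ^ m::'k:]"
    by (simp only: dvd_mult)
  \<comment> \<open>Two remainders of degree at most 1 differ by a multiple of a quadratic
    polynomial, so they coincide.\<close>
  from dvd_diff [OF uv this] have "[:-2, 0, 1:] dvd [:1 - u, 2 ^ m - v:]"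
    by simp
  then have "v = 2 ^ m"
    by (auto dest: dvd_imp_degree_le split: if_splits)
  \<comment> \<open>Hence \<open>v\<close> is nonzero, and so is the off-diagonal entry
    \<open>-v\<close>.\<close>
  moreover have "(2::'k) \<noteq> 0"
    using assms by (simp add: two_nonzero)
  ultimately show False
    using scalar by (simp add: pow)
qed

section \<open>The map given by the generating triple\<close>

lemma generators_eq:
  fixes \<alpha> :: "'k::field"
  assumes "\<alpha>\<^sup>2 = -1"
  shows "Xpp \<alpha> = pgl_class (mat22 1 0 2 (-1))" "Ypp \<alpha> = pgl_class (mat22 1 (-1) 0 (-1))"
    "Zpp \<alpha> = pgl_class (mat22 1 0 0 (-1))"
proof -
  have "\<alpha> \<noteq> 0"
    using assms by auto
  then show "Xpp \<alpha> = pgl_class (mat22 1 0 2 (-1))" "Ypp \<alpha> = pgl_class (mat22 1 (-1) 0 (-1))"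
    "Zpp \<alpha> = pgl_class (mat22 1 0 0 (-1))"
    by (simp_all add: Xpp_def Ypp_def Zpp_def pgl_class_scale flip: mat22_def)
qed

theorem proposition3p2:
  fixes p :: nat and \<alpha> :: "'k::field"
  assumes "Factorial_Ring.prime p" and "odd p"
    and "1 / real p + 1 / real p < 1 / 2"
    and "alg_closure_of_GF TYPE('k) p"
    and "\<alpha>\<^sup>2 = -1"
  shows "regular_map p p (Gpp \<alpha>) (Xpp \<alpha>) (Ypp \<alpha>) (Zpp \<alpha>) \<and>
    \<not> self_Petrie_dual (Gpp \<alpha>) (Xpp \<alpha>) (Ypp \<alpha>) (Zpp \<alpha>)"
proof -
  have char: "CHAR('k) = p"
    using assms(4) by (simp add: alg_closure_of_GF_def)
  have p0: "of_nat p = (0::'k)"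
    using of_nat_CHAR [where ?'a = 'k] char by simp
  have two: "(2::'k) \<noteq> 0"
    using assms char by (simp add: two_nonzero)
  let ?G = "Gpp \<alpha>" and ?x = "Xpp \<alpha>" and ?y = "Ypp \<alpha>" and ?z = "Zpp \<alpha>"
  note gens = generators_eq [OF assms(5)]
  have gens_PGL2: "{?x, ?y, ?z} \<subseteq> carrier PGL2"
    by (simp add: gens pgl_class_closed)
  have sub: "subgroup (generate PGL2 {?x, ?y, ?z}) PGL2"
    by (rule group.generate_is_subgroup [OF group_PGL2 gens_PGL2])
  interpret G: group ?G
    unfolding Gpp_def by (rule group.subgroup_imp_group [OF group_PGL2 sub])
  have G_simps: "a \<otimes>\<^bsub>?G\<^esub> b = a \<otimes>\<^bsub>PGL2\<^esub> b" "\<one>\<^bsub>?G\<^esub> = \<one>\<^bsub>PGL2\<^esub>"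
    "a [^]\<^bsub>?G\<^esub> (n::nat) = a [^]\<^bsub>PGL2\<^esub> n" for a b n
    by (simp_all add: Gpp_def nat_pow_def)
  have carrier_G: "carrier ?G = generate PGL2 {?x, ?y, ?z}"
    by (simp add: Gpp_def)
  have gens_G: "?x \<in> carrier ?G" "?y \<in> carrier ?G" "?z \<in> carrier ?G"
    by (auto simp: carrier_G intro: generate.incl)
  \<comment> \<open>Generation inside the subgroup agrees with generation inside
    \<open>PGL2\<close>.\<close>
  have generate_G: "generate ?G {?x, ?y, ?z} = carrier ?G"
    unfolding Gpp_def using gens_G
    by (subst group.generate_consistent [OF group_PGL2 _ sub]) (auto simp: carrier_G)
  have xy: "?x \<otimes>\<^bsub>?G\<^esub> ?y = pgl_class (mat22 1 (-1) 2 (-1))"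
    and yz: "?y \<otimes>\<^bsub>?G\<^esub> ?z = pgl_class (mat22 1 1 0 1)"
    and zx: "?z \<otimes>\<^bsub>?G\<^esub> ?x = pgl_class (mat22 1 0 (-2) 1)"
    and zxy: "?z \<otimes>\<^bsub>?G\<^esub> (?x \<otimes>\<^bsub>?G\<^esub> ?y) = pgl_class (mat22 1 (-1) (-2) 1)"
    by (simp_all add: gens G_simps pgl_class_mult)
  have ord: "G.ord (pgl_class A) = q"
    if "pgl_class A \<in> carrier ?G" "invertible A" "Factorial_Ring.prime q"
      "A [^]\<^bsub>GL2\<^esub> q \<in> scalars2" "A \<notin> scalars2" for A q
    using that
    by (intro G.ord_eq_prime) (simp_all add: G_simps pgl_class_pow_eq_one_iff pgl_class_eq_one_iff)
  have "regular_map p p ?G ?x ?y ?z"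
    unfolding regular_map_def
  proof (intro conjI)
    \<comment> \<open>The three matrices square to the identity. They have diagonal entries 1 and
      -1, which differ as 2 is nonzero, so none is scalar.\<close>
    show "G.ord ?x = 2" "G.ord ?y = 2" "G.ord ?z = 2"
      using gens_G two by (auto simp: gens GL2_pow_two intro!: ord)
    \<comment> \<open>This matrix squares to -1, which is trivial only up to scalars.\<close>
    show "G.ord (?x \<otimes>\<^bsub>?G\<^esub> ?y) = 2"
      using G.m_closed [OF gens_G(1,2)] two unfolding xy
      by (intro ord) (auto simp: GL2_pow_two)
    \<comment> \<open>In the p-th power of a unipotent matrix the off-diagonal entry is multiplied
      by \<open>p\<close>, which is 0 in the field.\<close>
    show "G.ord (?y \<otimes>\<^bsub>?G\<^esub> ?z) = p"
      using G.m_closed [OF gens_G(2,3)] assms(1) unfolding yz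
      by (intro ord) (auto simp: GL2_pow_unipotent p0)
    show "G.ord (?z \<otimes>\<^bsub>?G\<^esub> ?x) = p"
      using G.m_closed [OF gens_G(3,1)] assms(1) two unfolding zx
      by (intro ord) (auto simp: GL2_pow_unipotent p0)
  qed (use gens_G generate_G G.is_group in auto)
  moreover have "\<not> self_Petrie_dual ?G ?x ?y ?z"
  proof
    assume "self_Petrie_dual ?G ?x ?y ?z"
    then obtain \<phi> where \<phi>: "\<phi> \<in> iso ?G ?G" "\<phi> ?z = ?z" "\<phi> ?x = ?x \<otimes>\<^bsub>?G\<^esub> ?y"
      by (auto simp: self_Petrie_dual_def)
    interpret \<phi>: group_hom ?G ?G \<phi>
      using \<phi>(1) by unfold_locales (simp add: iso_def)
    \<comment> \<open>As \<open>\<phi>\<close> fixes Z and sends X to XY, it carries the trivial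
      element (ZX)^p to (ZXY)^p.\<close>
    have "(?z \<otimes>\<^bsub>?G\<^esub> (?x \<otimes>\<^bsub>?G\<^esub> ?y)) [^]\<^bsub>?G\<^esub> p = \<phi> ((?z \<otimes>\<^bsub>?G\<^esub> ?x) [^]\<^bsub>?G\<^esub> p)"
      using gens_G by (simp add: \<phi>.hom_nat_pow \<phi>)
    also have "(?z \<otimes>\<^bsub>?G\<^esub> ?x) [^]\<^bsub>?G\<^esub> p = \<one>\<^bsub>?G\<^esub>"
      unfolding zx by (simp add: G_simps pgl_class_pow_eq_one_iff GL2_pow_unipotent p0)
    also note \<phi>.hom_one
    finally have "pgl_class (mat22 1 (-1) (-2) (1::'k)) [^]\<^bsub>PGL2\<^esub> p = \<one>\<^bsub>PGL2\<^esub>"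
      unfolding zxy by (simp add: G_simps)
    moreover have "invertible (mat22 1 (-1) (-2) (1::'k))"
      by simp
    ultimately show False
      using GL2_pow_ZXY_not_scalar [OF assms(1,2) char] by (simp only: pgl_class_pow_eq_one_iff)
  qed
  ultimately show ?thesis ..
qed

end
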